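(* Let $R$ be an integral domain containing $\mathbb{Z}$. Suppose that $f(x)=a_1 x+a_2 x^2+\cdots$ and $g(x)=b_0+b_1x+b_2x^2+\cdots$ are two power series in $R[[x]]$. Then $g(f(x))=c_0+c_1x+c_2x^2+\cdots$ is in $R[[x]]$ with, for every $n\geq 0$, $$c_n=\sum_{k=0}^n b_k\cdot \mathcal{A}_{n,k}(a_1,a_2,\dots).$$
   Context: $R[[x]]$ is the ring of formal power series over $R$ (commutative). For integers $n,k$ with $k\geq 0$, the De Moivre polynomial $\mathcal{A}_{n,k}(a_1,a_2,a_3,\dots)$ is the coefficient of $x^n$ in the $k$th power of the formal series without constant term with coefficients $a_j$: $$(a_1x+a_2x^2+a_3x^3+\cdots)^k=\sum_{n\in\mathbb{Z}}\mathcal{A}_{n,k}(a_1,a_2,a_3,\dots)\,x^n .$$ It is $0$ if $n<k$; if $n\geq k$ it is a polynomial with integer coefficients in $a_1,\dots,a_{n-k+1}$, and can be evaluated at elements of any commutative ring. In particular $\mathcal{A}_{n,0}=1$ if $n=0$ and $0$ otherwise. *)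

theory Defs
  imports "HOL-Computational_Algebra.Formal_Power_Series"
begin

text \<open>The series \<open>a 1 x + a 2 x\<^sup>2 + a 3 x\<^sup>3 + \<dots>\<close>; the value \<open>a 0\<close> is ignored.\<close>

definition fps_no_const :: "(nat \<Rightarrow> 'a::comm_ring_1) \<Rightarrow> 'a fps" where
  "fps_no_const a = Abs_fps (\<lambda>j. if j = 0 then 0 else a j)"

text \<open>The De Moivre polynomial \<open>A\<^bsub>n,k\<^esub>\<close> evaluated at \<open>a 1, a 2, \<dots>\<close> in a commutative ring. A power
  series has no terms of negative degree, so the value is 0 for \<open>n < 0\<close>.\<close>

definition de_moivre :: "int \<Rightarrow> nat \<Rightarrow> (nat \<Rightarrow> 'a::comm_ring_1) \<Rightarrow> 'a" where
  "de_moivre n k a = (if n < 0 then 0 else fps_nth (fps_no_const a ^ k) (nat n))"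

end

theory Submission
  imports Defs
begin

text \<open>
  Since \<open>f\<close> has no constant term, \<open>f ^ k\<close> is divisible by \<open>x ^ k\<close>. The coefficient of \<open>x ^ n\<close> in
  \<open>\<Sum>k. b k * f ^ k\<close> therefore only receives contributions from \<open>k \<le> n\<close>: the partial sums are
  eventually constant in every degree, which is exactly convergence for the \<open>x\<close>-adic topology
  (\<open>fps_compose_sums\<close>), and the stable value is the finite sum that defines the composition.
  The coefficient formula is then that finite sum, with the coefficients of the powers of \<open>f\<close>
  read as De Moivre polynomials.
\<close>

text \<open>Composition is defined coefficientwise by finite sums; this lemma identifies it with the limit
  that the notation \<open>G(F(x))\<close> stands for. From the partial sum with \<open>n + 1\<close> terms onwards, the
  coefficient of \<open>x ^ n\<close> no longer changes.\<close>

lemma fps_compose_sums: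
  fixes F G :: "'a::comm_ring_1 fps"
  assumes "fps_nth F 0 = 0"
  shows "(\<lambda>k. fps_const (fps_nth G k) * F ^ k) sums (fps_compose G F)"
  unfolding sums_def
proof (rule tendsto_fpsI)
  fix n
  have "fps_nth (\<Sum>k<K. fps_const (fps_nth G k) * F ^ k) n = fps_nth (fps_compose G F) n"
    if "n < K" for K
  proof -
    have "(\<Sum>k<K. fps_nth G k * fps_nth (F ^ k) n) = (\<Sum>k = 0..n. fps_nth G k * fps_nth (F ^ k) n)"
      using that startsby_zero_power_prefix[OF assms]
      by (intro sum.mono_neutral_right) auto
    then show ?thesis
      by (simp add: fps_sum_nth fps_compose_nth)
  qed
  then show "\<forall>\<^sub>F K in sequentially.
      fps_nth (\<Sum>k<K. fps_const (fps_nth G k) * F ^ k) n = fps_nth (fps_compose G F) n"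
    by (rule eventually_mono[OF eventually_gt_at_top])
qed

theorem proposition3p1:
  fixes a b :: "nat \<Rightarrow> 'a :: {idom, ring_char_0}"
    and f g :: "'a fps"
  assumes "f = fps_no_const a"
    and "g = Abs_fps b"
  shows "(\<lambda>k. fps_const (b k) * f ^ k) sums (fps_compose g f) \<and>
         (\<forall>n::nat. fps_nth (fps_compose g f) n = (\<Sum>k = 0..n. b k * de_moivre (int n) k a))"
proof
  have "fps_nth f 0 = 0"
    by (simp add: assms(1) fps_no_const_def)
  from fps_compose_sums[OF this, of g]
  show "(\<lambda>k. fps_const (b k) * f ^ k) sums (fps_compose g f)"
    by (simp add: assms(2))
  show "\<forall>n::nat. fps_nth (fps_compose g f) n = (\<Sum>k = 0..n. b k * de_moivre (int n) k a)"
    by (simp add: assms fps_compose_nth de_moivre_def)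
qed

end
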